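(* Let $n\geq 3$ be an integer and let $C_n$ be the cycle of order $n$. If $n\equiv 1 \pmod 3$ or $n\equiv 2\pmod 3$, then $C_n$ is an SR-graph. Otherwise (i.e. if $n\equiv 0\pmod 3$), $C_n$ is an ASR-graph.
   Context: $\gamma(G)$ denotes the domination number of a finite simple graph $G$. For an edge $e=uv$ of $G$, $G-e$ is the graph obtained by deleting $e$, and $G_e$ is the graph obtained by subdividing $e$: delete $e$, add a new vertex $w$ and the edges $uw$ and $wv$. A finite connected simple graph $G$ of order at least two is an SR-graph (sub-removable graph) if $\gamma(G-e)=\gamma(G_e)$ for every edge $e$ of $G$, and an ASR-graph (anti-sub-removable graph) if $\gamma(G-e)\neq\gamma(G_e)$ for every edge $e$ of $G$. *)

theory Defs
  imports "Graph_Theory.Pair_Digraph" "Graph_Theory.Digraph_Component"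
begin

text \<open>
  A finite simple graph is a \<^locale>\<open>pair_graph\<close>: a finite, loop-free, symmetric digraph without
  parallel arcs. The undirected edge joining u and v is the pair of arcs (u,v) and (v,u).
\<close>

definition dominating_set :: "'a pair_pre_digraph \<Rightarrow> 'a set \<Rightarrow> bool" where
  "dominating_set G D \<longleftrightarrow>
     D \<subseteq> pverts G \<and> (\<forall>v \<in> pverts G - D. \<exists>u \<in> D. (u, v) \<in> parcs G)"

definition domination_number :: "'a pair_pre_digraph \<Rightarrow> nat" where
  "domination_number G = Min (card ` {D. dominating_set G D})"

definition delete_edge :: "'a pair_pre_digraph \<Rightarrow> 'a \<times> 'a \<Rightarrow> 'a pair_pre_digraph" where
  "delete_edge G e = \<lparr> pverts = pverts G, parcs = parcs G - {e, prod.swap e} \<rparr>"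

text \<open>
  The library function \<^const>\<open>subdivide\<close> takes the new vertex as an argument, and it has to be fresh.
  A copy of G over the option type always has one, namely \<^const>\<open>None\<close>, even if
  the vertices of G exhaust their type.
\<close>

definition subdivide_edge :: "'a pair_pre_digraph \<Rightarrow> 'a \<times> 'a \<Rightarrow> 'a option pair_pre_digraph" where
  "subdivide_edge G e =
     subdivide \<lparr> pverts = Some ` pverts G, parcs = map_prod Some Some ` parcs G \<rparr>
       (map_prod Some Some e) None"

definition SR_graph :: "'a pair_pre_digraph \<Rightarrow> bool" where
  "SR_graph G \<longleftrightarrow>
     pair_graph G \<and> Digraph_Component.connected (with_proj G) \<and> 2 \<le> card (pverts G) \<and>
     (\<forall>e \<in> parcs G. domination_number (delete_edge G e) = domination_number (subdivide_edge G e))"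

definition ASR_graph :: "'a pair_pre_digraph \<Rightarrow> bool" where
  "ASR_graph G \<longleftrightarrow>
     pair_graph G \<and> Digraph_Component.connected (with_proj G) \<and> 2 \<le> card (pverts G) \<and>
     (\<forall>e \<in> parcs G. domination_number (delete_edge G e) \<noteq> domination_number (subdivide_edge G e))"

text \<open>Intended for orders n at least 3; smaller n do not give a cycle.\<close>

definition cycle_graph :: "nat \<Rightarrow> nat pair_pre_digraph" where
  "cycle_graph n =
     \<lparr> pverts = {..<n},
       parcs = {(i, j). i < n \<and> j < n \<and> (j = (i + 1) mod n \<or> i = (j + 1) mod n)} \<rparr>"

end

theory Submission
  imports Defs "HOL-Number_Theory.Cong"
begin

text \<open>
  Deleting an edge of the n-cycle leaves a path on n vertices, and subdividing it gives a cycle on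
  n + 1 vertices. A graph on m vertices that contains a spanning path and is contained in a cycle
  along that path has domination number (m + 2) div 3: a vertex dominates at most three vertices,
  and every third vertex of the path suffices. Now (n + 2) div 3 = (n + 3) div 3 unless 3 divides n.
\<close>

text \<open>\<open>Min\<close> in \<open>domination_number\<close> is meaningful only on a finite
  set.\<close>

lemma finite_dominating_sets:
  assumes "finite (pverts G)"
  shows "finite {D. dominating_set G D}"
  by (rule finite_subset[of _ "Pow (pverts G)"]) (use assms in \<open>auto simp: dominating_set_def\<close>)

lemma domination_number_eqI:
  assumes "finite (pverts G)" "dominating_set G D" "card D \<le> k"
    and "\<And>D'. dominating_set G D' \<Longrightarrow> k \<le> card D'"
  shows "domination_number G = k"
  unfolding domination_number_def
proof (rule Min_eqI)
  show "finite (card ` {D. dominating_set G D})"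
    using assms(1) by (simp add: finite_dominating_sets)
  have "card D = k" using assms(2-4) by (simp add: le_antisym)
  then show "k \<in> card ` {D. dominating_set G D}" using assms(2) by blast
qed (use assms(4) in auto)

text \<open>The closed neighbourhoods of the vertices in D cover the graph, and each lies in some
  {v, x, y}. The degree bound names two candidates, possibly equal, so that no neighbours have to be
  counted.\<close>

lemma card_le_3_times_dominating_set:
  assumes fin: "finite (pverts G)"
    and deg: "\<And>v. v \<in> pverts G \<Longrightarrow> \<exists>x y. \<forall>w \<in> pverts G. (v, w) \<in> parcs G \<longrightarrow> w = x \<or> w = y"
    and D: "dominating_set G D"
  shows "card (pverts G) \<le> 3 * card D"
proof -
  define N where "N v = insert v {w \<in> pverts G. (v, w) \<in> parcs G}" for v
  have D_sub: "D \<subseteq> pverts G" using D by (simp add: dominating_set_def)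
  have finD: "finite D" using D_sub fin by (rule finite_subset)
  have N: "card (N v) \<le> 3" if v: "v \<in> D" for v
  proof -
    obtain x y where "\<forall>w \<in> pverts G. (v, w) \<in> parcs G \<longrightarrow> w = x \<or> w = y"
      using deg[of v] v D_sub by blast
    then have "N v \<subseteq> {v, x, y}" by (auto simp: N_def)
    then have "card (N v) \<le> card {v, x, y}" by (intro card_mono) auto
    also have "\<dots> \<le> 3" by (simp add: card_insert_if)
    finally show ?thesis .
  qed
  have "pverts G \<subseteq> (\<Union>v\<in>D. N v)"
    using D by (fastforce simp: dominating_set_def N_def)
  moreover have "finite (\<Union>v\<in>D. N v)" using finD fin by (auto simp: N_def)
  ultimately have "card (pverts G) \<le> card (\<Union>v\<in>D. N v)" by (rule card_mono[rotated])
  also have "\<dots> \<le> (\<Sum>v\<in>D. card (N v))" by (rule card_UN_le[OF finD])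
  also have "\<dots> \<le> 3 * card D" using sum_bounded_above[of D "\<lambda>v. card (N v)" 3] N by simp
  finally show ?thesis .
qed

text \<open>Makes the cyclic predecessor of i explicit, so that it can serve as the second candidate
  neighbour in the degree bound.\<close>

lemma Suc_mod_eq_iff:
  assumes "i < m" "j < m"
  shows "i = Suc j mod m \<longleftrightarrow> j = (if i = 0 then m - 1 else i - 1)"
  using assms by (cases "Suc j = m") auto

text \<open>\<open>path\<close> yields the upper bound and \<open>cycle\<close> the lower one. The
  edge between the last and the first vertex may be present or absent, so both modified cycles are
  covered.\<close>

lemma domination_number_between_path_and_cycle:
  assumes bij: "bij_betw f {..<m} (pverts G)"
    and path: "\<And>i. Suc i < m \<Longrightarrow> (f i, f (Suc i)) \<in> parcs G \<and> (f (Suc i), f i) \<in> parcs G"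
    and cycle: "\<And>i j. i < m \<Longrightarrow> j < m \<Longrightarrow> (f i, f j) \<in> parcs G \<Longrightarrow>
                  j = Suc i mod m \<or> i = Suc j mod m"
  shows "domination_number G = (m + 2) div 3"
proof (rule domination_number_eqI)
  have verts: "pverts G = f ` {..<m}" using bij by (simp add: bij_betw_def)
  then show fin: "finite (pverts G)" by simp
  \<comment> \<open>The middle of the k-th block 3k, 3k+1, 3k+2 of indices. The cap matters only
    when m mod 3 = 1: the last block is then the single index m - 1.\<close>
  define t where "t k = min (3 * k + 1) (m - 1)" for k
  define D where "D = (\<lambda>k. f (t k)) ` {..<(m + 2) div 3}"
  show "card D \<le> (m + 2) div 3"
    unfolding D_def by (metis card_image_le card_lessThan finite_lessThan)
  show "dominating_set G D"
    unfolding dominating_set_def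
  proof (intro conjI ballI)
    have "t k < m" if "k < (m + 2) div 3" for k using that by (auto simp: t_def)
    then show "D \<subseteq> pverts G" by (auto simp: D_def verts)
    fix v assume v: "v \<in> pverts G - D"
    then obtain i where i: "i < m" "v = f i" by (auto simp: verts)
    have *: "i div 3 < (m + 2) div 3" using i by linarith
    then have "f (t (i div 3)) \<in> D" by (auto simp: D_def)
    \<comment> \<open>Index i is at distance at most one from the middle of its block; if the cap
      applies, i itself is m - 1.\<close>
    moreover have "t (i div 3) = i \<or> Suc i = t (i div 3) \<or> Suc (t (i div 3)) = i"
      using i unfolding t_def min_def by (cases "3 * (i div 3) + 1 \<le> m - 1") (simp; linarith)+
    moreover have "t (i div 3) < m" using i by (auto simp: t_def)
    ultimately show "\<exists>u\<in>D. (u, v) \<in> parcs G"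
      using path i v by (metis DiffD2)
  qed
  fix D' assume D': "dominating_set G D'"
  have "card (pverts G) \<le> 3 * card D'"
  proof (rule card_le_3_times_dominating_set[OF fin _ D'])
    fix v assume "v \<in> pverts G"
    then obtain i where i: "i < m" "v = f i" by (auto simp: verts)
    have "w = f (Suc i mod m) \<or> w = f (if i = 0 then m - 1 else i - 1)"
      if w: "w \<in> pverts G" "(v, w) \<in> parcs G" for w
    proof -
      obtain j where "j < m" "w = f j" using w by (auto simp: verts)
      then show ?thesis using cycle[of i j] i w Suc_mod_eq_iff[of i m j] by auto
    qed
    then show "\<exists>x y. \<forall>w \<in> pverts G. (v, w) \<in> parcs G \<longrightarrow> w = x \<or> w = y" by blast
  qed
  moreover have "card (pverts G) = m" using bij_betw_same_card[OF bij] by simp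
  \<comment> \<open>\<open>(m + 2) div 3\<close> is m / 3 rounded up.\<close>
  ultimately show "(m + 2) div 3 \<le> card D'" by linarith
qed

lemma pverts_cycle_graph: "pverts (cycle_graph n) = {..<n}"
  by (simp add: cycle_graph_def)

lemma bij_betw_add_mod:
  fixes c n :: nat
  assumes "n > 0"
  shows "bij_betw (\<lambda>i. (c + i) mod n) {..<n} {..<n}"
proof -
  have "inj_on (\<lambda>i. (c + i) mod n) {..<n}"
    by (rule inj_onI) (metis cong_def cong_add_lcancel_nat cong_less_modulus_unique_nat lessThan_iff)
  moreover have "(\<lambda>i. (c + i) mod n) ` {..<n} \<subseteq> {..<n}" using assms by auto
  ultimately show ?thesis by (simp add: bij_betw_def endo_inj_surj)
qed

text \<open>Rotational symmetry: the shift c cancels from the congruences that define adjacency.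
  Numbering can therefore start at any vertex.\<close>

lemma cycle_graph_rotate:
  assumes "n > 0" "i < n" "j < n"
  shows "((c + i) mod n, (c + j) mod n) \<in> parcs (cycle_graph n) \<longleftrightarrow>
           j = Suc i mod n \<or> i = Suc j mod n"
proof -
  have "(c + y) mod n = ((c + x) mod n + 1) mod n \<longleftrightarrow> y = Suc x mod n" if "y < n" for x y
  proof -
    have "(c + y) mod n = ((c + x) mod n + 1) mod n \<longleftrightarrow> [c + y = c + Suc x] (mod n)"
      by (simp add: cong_def mod_simps)
    also have "\<dots> \<longleftrightarrow> y = Suc x mod n"
      using that by (simp only: cong_add_lcancel_nat) (simp add: cong_def)
    finally show ?thesis .
  qed
  then show ?thesis using assms by (simp add: cycle_graph_def)
qed

text \<open>With its analogue for subdivision, this allows every edge to be oriented from a vertex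
  to its cyclic successor.\<close>

lemma delete_edge_swap: "delete_edge G (prod.swap e) = delete_edge G e"
  by (simp add: delete_edge_def insert_commute)

lemma subdivide_edge_swap: "subdivide_edge G (prod.swap e) = subdivide_edge G e"
  by (cases e) (auto simp: subdivide_edge_def subdivide.simps)

lemma domination_number_cycle_graph_edge:
  assumes n: "n \<ge> 3" and e: "e \<in> parcs (cycle_graph n)"
  shows "domination_number (delete_edge (cycle_graph n) e) = (n + 2) div 3"
    and "domination_number (subdivide_edge (cycle_graph n) e) = (n + 3) div 3"
proof -
  obtain a b where ab: "a < n" "b = (a + 1) mod n" "e = (a, b) \<or> e = prod.swap (a, b)"
    using e by (cases e) (auto simp: cycle_graph_def)
  \<comment> \<open>Numbering starts just after a, so the chosen edge joins the last vertex to the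
    first and the other edges form a path.\<close>
  define f where "f i = (Suc a + i) mod n" for i
  have bij: "bij_betw f {..<n} {..<n}"
    using n bij_betw_add_mod[of n "Suc a"] by (simp add: f_def[abs_def])
  then have inj: "f i = f j \<longleftrightarrow> i = j" if "i < n" "j < n" for i j
    using that by (auto simp: bij_betw_def inj_on_def)
  have f_arc: "(f i, f j) \<in> parcs (cycle_graph n) \<longleftrightarrow> j = Suc i mod n \<or> i = Suc j mod n"
    if "i < n" "j < n" for i j
    using that n unfolding f_def by (intro cycle_graph_rotate) auto
  have ends: "a = f (n - 1)" "b = f 0" using n ab by (auto simp: f_def)
  \<comment> \<open>Consecutive indices are not the two extreme ones, because n \<ge> 3; for n = 2
    this would fail.\<close>
  have arc_ne: "(f i, f (Suc i)) \<notin> {(a, b), (b, a)}" "(f (Suc i), f i) \<notin> {(a, b), (b, a)}"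
    if "Suc i < n" for i
    using that n by (auto simp: ends inj)

  have "domination_number (delete_edge (cycle_graph n) (a, b)) = (n + 2) div 3"
    by (rule domination_number_between_path_and_cycle[of f])
       (use bij arc_ne in \<open>auto simp: delete_edge_def pverts_cycle_graph f_arc\<close>)
  then show "domination_number (delete_edge (cycle_graph n) e) = (n + 2) div 3"
    using ab(3) by (metis delete_edge_swap)

  \<comment> \<open>The new vertex receives index n, between a at n - 1 and b at 0 in the cyclic
    order modulo n + 1.\<close>
  define g where "g i = (if i < n then Some (f i) else None)" for i
  have arcs: "parcs (subdivide_edge (cycle_graph n) (a, b)) =
      map_prod Some Some ` (parcs (cycle_graph n) - {(a, b), (b, a)}) \<union>
      {(Some a, None), (None, Some a), (None, Some b), (Some b, None)}"
    by (auto simp: subdivide_edge_def)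
  have bij_g: "bij_betw g {..<Suc n} (pverts (subdivide_edge (cycle_graph n) (a, b)))"
  proof -
    have "inj_on g {..<Suc n}" using inj by (auto simp: inj_on_def g_def split: if_splits)
    moreover have "g ` {..<Suc n} = insert None (Some ` f ` {..<n})"
      by (auto simp: lessThan_Suc g_def image_iff)
    ultimately show ?thesis
      using bij by (simp add: bij_betw_def subdivide_edge_def pverts_cycle_graph)
  qed
  have "domination_number (subdivide_edge (cycle_graph n) (a, b)) = (Suc n + 2) div 3"
  proof (rule domination_number_between_path_and_cycle[OF bij_g])
    fix i assume i: "Suc i < Suc n"
    show "(g i, g (Suc i)) \<in> parcs (subdivide_edge (cycle_graph n) (a, b)) \<and>
          (g (Suc i), g i) \<in> parcs (subdivide_edge (cycle_graph n) (a, b))"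
    proof (cases "Suc i = n")
      case True
      then show ?thesis unfolding arcs using ends by (auto simp: g_def)
    next
      case False
      then have "Suc i < n" using i by simp
      then show ?thesis using arc_ne[of i] f_arc[of i "Suc i"] f_arc[of "Suc i" i]
        by (force simp: g_def arcs)
    qed
  next
    fix i j assume ij: "i < Suc n" "j < Suc n"
      and arc: "(g i, g j) \<in> parcs (subdivide_edge (cycle_graph n) (a, b))"
    consider "i < n" "j < n" | "i = n" "j < n" | "i < n" "j = n" | "i = n" "j = n"
      using ij by linarith
    then show "j = Suc i mod Suc n \<or> i = Suc j mod Suc n"
    proof cases
      case 1
      then have *: "(f i, f j) \<in> parcs (cycle_graph n)" "(f i, f j) \<notin> {(a, b), (b, a)}"
        using arc by (auto simp: g_def arcs)
      \<comment> \<open>A wraparound modulo n would give one of the two removed arcs, so the indices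
        differ by exactly one and are also adjacent modulo n + 1.\<close>
      have "Suc i = j \<or> Suc j = i"
        using * 1 n f_arc[of i j] by (cases "Suc i = n"; cases "Suc j = n") (auto simp: ends)
      then show ?thesis using 1 by auto
    next
      case 2
      \<comment> \<open>The new vertex is adjacent only to a and b, whose indices n - 1 and 0 are
        the cyclic neighbours of n modulo n + 1.\<close>
      then have "f j = f (n - 1) \<or> f j = f 0" using arc unfolding arcs unfolding ends by (auto simp: g_def)
      then have "j = n - 1 \<or> j = 0" using 2 n inj by auto
      then show ?thesis using 2 n by auto
    next
      case 3
      then have "f i = f (n - 1) \<or> f i = f 0" using arc unfolding arcs unfolding ends by (auto simp: g_def)
      then have "i = n - 1 \<or> i = 0" using 3 n inj by auto
      then show ?thesis using 3 n by auto
    next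
      case 4
      then show ?thesis using arc by (auto simp: g_def arcs)
    qed
  qed
  then show "domination_number (subdivide_edge (cycle_graph n) e) = (n + 3) div 3"
    using ab(3) subdivide_edge_swap[of "cycle_graph n" "(a, b)"] by (auto simp: add.commute)
qed

lemma pair_graph_cycle_graph:
  assumes "n \<ge> 2"
  shows "pair_graph (cycle_graph n)"
proof
  have "parcs (cycle_graph n) \<subseteq> {..<n} \<times> {..<n}" by (auto simp: cycle_graph_def)
  then show "finite (parcs (cycle_graph n))" by (rule finite_subset) simp
  \<comment> \<open>No loops: this needs n \<ge> 2, since for n = 1 the sole vertex is its own
    successor.\<close>
  have "x \<noteq> (x + 1) mod n" if "x < n" for x
    using that assms by (cases "x + 1 = n") auto
  then show "fst e \<noteq> snd e" if "e \<in> parcs (cycle_graph n)" for e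
    using that by (fastforce simp: cycle_graph_def)
  show "symmetric (with_proj (cycle_graph n))"
    by (auto simp: symmetric_def arcs_ends_conv intro!: symI) (auto simp: cycle_graph_def)
qed (auto simp: cycle_graph_def)

lemma connected_cycle_graph:
  assumes "n \<ge> 2"
  shows "Digraph_Component.connected (with_proj (cycle_graph n))"
proof -
  interpret pair_graph "cycle_graph n" using assms by (rule pair_graph_cycle_graph)
  have zero: "0 \<rightarrow>\<^sup>*\<^bsub>with_proj (cycle_graph n)\<^esub> i" if "i < n" for i
    using that
  proof (induction i)
    case 0
    then show ?case by (intro reachable_refl) (simp add: cycle_graph_def)
  next
    case (Suc i)
    then have "(i, Suc i) \<in> parcs (cycle_graph n)" by (auto simp: cycle_graph_def)
    with Suc show ?case by (meson Suc_lessD reachable_adj_trans)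
  qed
  \<comment> \<open>Walk from u back to 0 by symmetry, then from 0 forward to v.\<close>
  have "u \<rightarrow>\<^sup>*\<^bsub>with_proj (cycle_graph n)\<^esub> v" if "u < n" "v < n" for u v
    using zero[OF that(1)] zero[OF that(2)] symmetric_reachable[OF sym_arcs]
    by (meson reachable_trans)
  then show ?thesis
    using assms by (intro connectedI reachable_mk_symmetricI) (auto simp: pverts_cycle_graph lessThan_empty_iff)
qed

theorem proposition3:
  fixes n :: nat
  assumes "n \<ge> 3"
  shows "(n mod 3 = 1 \<or> n mod 3 = 2 \<longrightarrow> SR_graph (cycle_graph n))
       \<and> (n mod 3 = 0 \<longrightarrow> ASR_graph (cycle_graph n))"
proof -
  have "pair_graph (cycle_graph n)" "Digraph_Component.connected (with_proj (cycle_graph n))"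
    "2 \<le> card (pverts (cycle_graph n))"
    using assms pair_graph_cycle_graph connected_cycle_graph by (auto simp: cycle_graph_def)
  moreover have "n mod 3 = 1 \<or> n mod 3 = 2 \<Longrightarrow> (n + 2) div 3 = (n + 3) div 3"
    and "n mod 3 = 0 \<Longrightarrow> (n + 2) div 3 \<noteq> (n + 3) div 3"
    by presburger+
  ultimately show ?thesis
    using domination_number_cycle_graph_edge[OF assms] by (auto simp: SR_graph_def ASR_graph_def)
qed

end
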